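(* Let $A\subseteq\mathbb{R}^n$ be a real algebraic set strictly contained in a hyperplane of $\mathbb{R}^n$, and let $\vec x_0\in A$. Then there exist $r>0$ and real polynomials $N,D$ in $n$ variables, $D\not\equiv 0$, such that the indeterminacy set of the rational function $N/D$ is equal to $A$, $N$ and $D$ have no common (non-constant polynomial) factors, $N/D$ is bounded on $B_r(\vec x_0)$, and the function $f:\mathbb{R}^n\to\mathbb{R}$ defined by $$f(\vec x)=\begin{cases}\dfrac{N(\vec x)}{D(\vec x)} & \text{for }\vec x\notin\mathcal{Z}(D),\\[2mm] 0 & \text{for }\vec x\in\mathcal{Z}(D)\end{cases}$$ is not continuous on any neighborhood of $\vec x_0$.
   Context: For a real polynomial $F$ in $n$ variables, $\mathcal{Z}(F)=\{\vec x\in\mathbb{R}^n: F(\vec x)=0\}$; a real algebraic set is a set of this form (equivalently, a finite intersection of such sets). The indeterminacy set of a rational function $N/D$ is $\mathcal{Z}(N)\cap\mathcal{Z}(D)$. $N/D$ is bounded on a set $\Delta$ if there is a constant $M$ with $|N(\vec x)/D(\vec x)|\le M$ for all $\vec x\in\Delta\setminus\mathcal{Z}(D)$. $B_r(\vec x_0)$ is the open Euclidean ball of radius $r$ and center $\vec x_0$. A hyperplane is an affine subspace of dimension $n-1$, and "strictly contained" means a proper subset. *)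

theory Defs
  imports "HOL-Analysis.Analysis" "HOL-Library.Poly_Mapping"
begin

text \<open>
  A monomial assigns to each variable \<open>i :: 'n\<close> its exponent; a polynomial assigns to each
  monomial its coefficient, all but finitely many being zero. The instances of
  \<open>HOL-Library.Poly_Mapping\<close> make this type a commutative ring with convolution as multiplication.
\<close>

type_synonym 'n rpoly = "('n \<Rightarrow>\<^sub>0 nat) \<Rightarrow>\<^sub>0 real"

definition peval :: "'n::finite rpoly \<Rightarrow> real ^ 'n \<Rightarrow> real" where
  "peval P x =
     (\<Sum>m\<in>Poly_Mapping.keys P.
        Poly_Mapping.lookup P m * (\<Prod>i\<in>UNIV. (x $ i) ^ Poly_Mapping.lookup m i))"

definition is_constant :: "'n rpoly \<Rightarrow> bool" where
  "is_constant P \<longleftrightarrow> (\<exists>c. P = Poly_Mapping.single 0 c)"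

definition zero_set :: "'n::finite rpoly \<Rightarrow> (real ^ 'n) set" where
  "zero_set P = {x. peval P x = 0}"

definition real_algebraic :: "(real ^ 'n::finite) set \<Rightarrow> bool" where
  "real_algebraic A \<longleftrightarrow> (\<exists>F. A = zero_set F)"

definition is_hyperplane :: "(real ^ 'n::finite) set \<Rightarrow> bool" where
  "is_hyperplane H \<longleftrightarrow> affine H \<and> aff_dim H = int CARD('n) - 1"

text \<open>
  A rational function is represented by a numerator \<open>N\<close> and a denominator \<open>D\<close>, since the
  indeterminacy set depends on the chosen fraction.
\<close>

definition indeterminacy_set :: "'n::finite rpoly \<Rightarrow> 'n rpoly \<Rightarrow> (real ^ 'n) set" where
  "indeterminacy_set N D = zero_set N \<inter> zero_set D"

definition no_common_factors :: "'n rpoly \<Rightarrow> 'n rpoly \<Rightarrow> bool" where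
  "no_common_factors N D \<longleftrightarrow> (\<forall>G. G dvd N \<and> G dvd D \<longrightarrow> is_constant G)"

definition ratfun_bounded_on ::
    "(real ^ 'n::finite) set \<Rightarrow> 'n rpoly \<Rightarrow> 'n rpoly \<Rightarrow> bool" where
  "ratfun_bounded_on \<Delta> N D \<longleftrightarrow>
     (\<exists>M. \<forall>x \<in> \<Delta> - zero_set D. \<bar>peval N x / peval D x\<bar> \<le> M)"

definition ratfun_extension ::
    "'n::finite rpoly \<Rightarrow> 'n rpoly \<Rightarrow> real ^ 'n \<Rightarrow> real" where
  "ratfun_extension N D x = (if x \<notin> zero_set D then peval N x / peval D x else 0)"

end

theory Submission
  imports Defs "HOL-Computational_Algebra.Polynomial"
begin

text \<open>
  Write \<open>A = Z(F)\<close> and let \<open>L\<close> be a linear equation of the hyperplane \<open>H\<close>. Take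
  \<open>N = L F\<^sup>2\<close> and \<open>D = L\<^sup>2 + F\<^sup>4\<close>; both vanish exactly on \<open>H \<inter> Z(F) = A\<close>, and
  \<open>\<bar>N / D\<bar> \<le> 1\<close> by AM-GM. A common factor \<open>P\<close> of \<open>N\<close> and \<open>D\<close> divides \<open>L\<^sup>3\<close> and \<open>F\<^sup>6\<close>.
  By the latter it does not vanish at a point \<open>y \<in> H - A\<close>, so on every line through \<open>y\<close>
  transversal to \<open>H\<close> it is a univariate divisor of \<open>c t\<^sup>3\<close> with no zero at \<open>t = 0\<close>,
  hence constant. Finally \<open>f = 0\<close> at \<open>x0\<close>, while \<open>f = 1/2\<close> wherever \<open>L = F\<^sup>2 \<noteq> 0\<close>; such points
  exist arbitrarily close to \<open>x0\<close> by the intermediate value theorem, because \<open>F\<^sup>2\<close> vanishes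
  to second order at \<open>x0\<close>.
\<close>

section \<open>Evaluation of polynomials\<close>

lemma peval_zero [simp]: "peval 0 x = 0"
  by (simp add: peval_def)

lemma peval_single:
  "peval (Poly_Mapping.single m c) x = c * (\<Prod>i\<in>UNIV. (x $ i) ^ Poly_Mapping.lookup m i)"
  by (simp add: peval_def)

lemma peval_add [simp]: "peval (P + Q) x = peval P x + peval Q x"
  unfolding peval_def
  by (rule Poly_Mapping.setsum_keys_plus_distrib) (simp_all add: algebra_simps)

lemma peval_diff [simp]: "peval (P - Q) x = peval P x - peval Q x"
  using peval_add [of "P - Q" Q x] by simp

lemma peval_sum: "peval (sum f S) x = (\<Sum>s\<in>S. peval (f s) x)"
  by (induction S rule: infinite_finite_induct) auto

lemma rpoly_eq_sum_single:
  fixes P :: "'n rpoly"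
  shows "P = (\<Sum>m\<in>Poly_Mapping.keys P. Poly_Mapping.single m (Poly_Mapping.lookup P m))"
proof (rule poly_mapping_eqI)
  fix k
  have "(\<Sum>m\<in>Poly_Mapping.keys P. (Poly_Mapping.lookup P m when m = k)) = Poly_Mapping.lookup P k"
    by (cases "k \<in> Poly_Mapping.keys P") (auto simp: when_def in_keys_iff sum.delta)
  then show "Poly_Mapping.lookup P k =
      Poly_Mapping.lookup (\<Sum>m\<in>Poly_Mapping.keys P. Poly_Mapping.single m (Poly_Mapping.lookup P m)) k"
    by (simp add: lookup_sum lookup_single)
qed

text \<open>By bilinearity only products of single monomials matter, and there exponents
  add.\<close>

lemma peval_mult [simp]: "peval (P * Q) x = peval P x * peval Q x"
proof -
  have single: "peval (Poly_Mapping.single m c * Poly_Mapping.single k d) x =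
      peval (Poly_Mapping.single m c) x * peval (Poly_Mapping.single k d) x" for m k c d
    by (simp add: mult_single peval_single lookup_add power_add prod.distrib)
  have "peval ((\<Sum>m\<in>S. Poly_Mapping.single m (c m)) * (\<Sum>k\<in>T. Poly_Mapping.single k (d k))) x =
      peval (\<Sum>m\<in>S. Poly_Mapping.single m (c m)) x * peval (\<Sum>k\<in>T. Poly_Mapping.single k (d k)) x"
    for S T c d
    by (simp add: sum_product peval_sum single)
  then show ?thesis
    using rpoly_eq_sum_single [of P] rpoly_eq_sum_single [of Q] by metis
qed

lemma peval_one [simp]: "peval 1 x = 1"
  using peval_single [of 0 1 x] by simp

lemma peval_power [simp]: "peval (P ^ n) x = peval P x ^ n"
  by (induction n) auto

lemma continuous_on_peval [continuous_intros]:
  "continuous_on S g \<Longrightarrow> continuous_on S (\<lambda>x. peval P (g x))"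
  unfolding peval_def by (intro continuous_intros)

lemma peval_affine_form:
  fixes a :: "real ^ 'n::finite"
  shows "\<exists>L. \<forall>x. peval L x = a \<bullet> x - b"
proof (intro exI allI)
  fix x :: "real ^ 'n"
  have "(\<Prod>j\<in>UNIV. (x $ j) ^ Poly_Mapping.lookup (Poly_Mapping.single i 1) j) = x $ i" for i
  proof -
    have "(\<Prod>j\<in>UNIV. (x $ j) ^ Poly_Mapping.lookup (Poly_Mapping.single i 1) j) =
        (\<Prod>j\<in>UNIV. if j = i then x $ j else 1)"
      by (rule prod.cong) (auto simp: lookup_single when_def)
    then show ?thesis by simp
  qed
  then show "peval ((\<Sum>i\<in>UNIV. Poly_Mapping.single (Poly_Mapping.single i 1) (a $ i)) -
      Poly_Mapping.single 0 b) x = a \<bullet> x - b"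
    by (simp add: peval_sum peval_single inner_vec_def)
qed

text \<open>Restriction to a line makes degrees, root orders and finiteness of roots
  available.\<close>

lemma peval_line:
  fixes P :: "'n::finite rpoly"
  shows "\<exists>p. \<forall>t. poly p t = peval P (y + t *\<^sub>R w)"
proof (intro exI allI)
  fix t
  show "poly (\<Sum>m\<in>Poly_Mapping.keys P. smult (Poly_Mapping.lookup P m)
      (\<Prod>i\<in>UNIV. [:y $ i, w $ i:] ^ Poly_Mapping.lookup m i)) t = peval P (y + t *\<^sub>R w)"
    by (simp add: peval_def poly_sum poly_prod)
qed

section \<open>Polynomials determined by their values\<close>

text \<open>
  Kronecker substitution \<open>x\<^sub>i = t ^ B ^ \<phi> i\<close> with \<open>\<phi>\<close> injective: for \<open>B\<close> outside the finitely many
  roots of the nonzero polynomials \<open>\<Sum>\<^sub>i (m\<^sub>i - k\<^sub>i) X ^ \<phi> i\<close>, different monomials \<open>m\<close>, \<open>k\<close>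
  become different powers of \<open>t\<close>.
\<close>

lemma separating_weights:
  fixes K :: "('n::finite \<Rightarrow>\<^sub>0 nat) set"
  assumes "finite K"
  shows "\<exists>v :: 'n \<Rightarrow> nat. inj_on (\<lambda>m. \<Sum>i\<in>UNIV. v i * Poly_Mapping.lookup m i) K"
proof -
  obtain \<phi> :: "'n \<Rightarrow> nat" where \<phi>: "inj \<phi>"
    using finite_imp_inj_to_nat_seg [OF finite [of "UNIV :: 'n set"]] by blast
  define q where "q m k = (\<Sum>i\<in>UNIV. monom (real (Poly_Mapping.lookup m i) -
      real (Poly_Mapping.lookup k i)) (\<phi> i))" for m k :: "'n \<Rightarrow>\<^sub>0 nat"
  have q_nz: "q m k \<noteq> 0" if "m \<noteq> k" for m k
  proof -
    obtain j where j: "Poly_Mapping.lookup m j \<noteq> Poly_Mapping.lookup k j"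
      using \<open>m \<noteq> k\<close> by (meson poly_mapping_eqI)
    have "coeff (q m k) (\<phi> j) = (\<Sum>i\<in>UNIV. if i = j then real (Poly_Mapping.lookup m i) -
        real (Poly_Mapping.lookup k i) else 0)"
      \<comment> \<open>Injectivity of \<open>\<phi>\<close> keeps the terms of different variables
        in different degrees.\<close>
      unfolding q_def coeff_sum using \<phi> by (intro sum.cong) (auto simp: inj_eq)
    then have "coeff (q m k) (\<phi> j) \<noteq> 0"
      using j by simp
    then show ?thesis by auto
  qed
  define R where "R = (\<Union>(m, k)\<in>K \<times> K - Id. {x. poly (q m k) x = 0})"
  have "finite R"
    unfolding R_def using assms q_nz by (auto intro!: poly_roots_finite)
  then have "finite (real -` R)"
    by (intro finite_vimageI) (auto simp: inj_def)
  then obtain B :: nat where B: "real B \<notin> R"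
    using ex_new_if_finite [OF infinite_UNIV_nat] by blast
  have "inj_on (\<lambda>m. \<Sum>i\<in>UNIV. B ^ \<phi> i * Poly_Mapping.lookup m i) K"
  proof (rule inj_onI, rule ccontr)
    fix m k assume mk: "m \<in> K" "k \<in> K" "m \<noteq> k"
      and eq: "(\<Sum>i\<in>UNIV. B ^ \<phi> i * Poly_Mapping.lookup m i) =
        (\<Sum>i\<in>UNIV. B ^ \<phi> i * Poly_Mapping.lookup k i)"
    have "poly (q m k) (real B) = real (\<Sum>i\<in>UNIV. B ^ \<phi> i * Poly_Mapping.lookup m i) -
        real (\<Sum>i\<in>UNIV. B ^ \<phi> i * Poly_Mapping.lookup k i)"
      by (simp add: q_def poly_sum poly_monom algebra_simps sum_subtractf)
    then have "real B \<in> R"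
      using mk eq unfolding R_def by auto
    with B show False ..
  qed
  then show ?thesis
    by (rule exI [of _ "\<lambda>i. B ^ \<phi> i"])
qed

text \<open>Substituting \<open>t ^ v i\<close> for the variables with separating weights
  \<open>v\<close> gives a univariate polynomial with the same coefficients as \<open>P\<close>;
  having every real as a root, it is zero.\<close>

lemma peval_eq_zero_imp:
  fixes P :: "'n::finite rpoly"
  assumes "\<And>x. peval P x = 0"
  shows "P = 0"
proof (rule poly_mapping_eqI)
  fix k
  obtain v :: "'n \<Rightarrow> nat" where
    inj: "inj_on (\<lambda>m. \<Sum>i\<in>UNIV. v i * Poly_Mapping.lookup m i) (Poly_Mapping.keys P)"
    using separating_weights [OF finite_keys] by blast
  define e where "e m = (\<Sum>i\<in>UNIV. v i * Poly_Mapping.lookup m i)" for m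
  define p where "p = (\<Sum>m\<in>Poly_Mapping.keys P. monom (Poly_Mapping.lookup P m) (e m))"
  have "poly p t = peval P (\<chi> i. t ^ v i)" for t
    by (simp add: p_def e_def peval_def poly_sum poly_monom power_sum power_mult)
  then have "p = 0"
    using assms by (simp add: poly_all_0_iff_0 [symmetric])
  show "Poly_Mapping.lookup P k = Poly_Mapping.lookup 0 k"
  proof (cases "k \<in> Poly_Mapping.keys P")
    case True
    have "coeff p (e k) = (\<Sum>m\<in>Poly_Mapping.keys P. if m = k then Poly_Mapping.lookup P m else 0)"
      unfolding p_def coeff_sum using inj True
      by (intro sum.cong) (auto simp: e_def inj_on_def)
    then show ?thesis
      using True \<open>p = 0\<close> by simp
  qed (simp add: in_keys_iff)
qed

lemma is_constant_if_peval_constant: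
  assumes "\<And>x. peval P x = c"
  shows "is_constant P"
proof -
  have "P - Poly_Mapping.single 0 c = 0"
    by (rule peval_eq_zero_imp) (simp add: assms peval_single)
  then show ?thesis
    unfolding is_constant_def by auto
qed

section \<open>Divisors of a power of a linear form\<close>

text \<open>All \<open>n\<close> zeros of the product at 0 must come from \<open>q\<close>, which
  uses up the whole degree \<open>n\<close>.\<close>

lemma degree_eq_0_if_mult_eq_monom:
  fixes p q :: "'a::idom poly"
  assumes "p * q = monom c n" "c \<noteq> 0" "poly p 0 \<noteq> 0"
  shows "degree p = 0"
proof -
  have nz: "p \<noteq> 0" "q \<noteq> 0" "p * q \<noteq> 0"
    using assms by auto
  have "monom 1 n dvd p * q"
    unfolding assms(1) by (simp add: monom_1_dvd_iff')
  then have "n \<le> order 0 p + order 0 q"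
    using nz by (simp add: monom_1_dvd_iff order_mult)
  moreover have "order 0 p = 0"
    using assms(3) by (simp add: order_0I)
  moreover have "order 0 q \<le> degree q"
    using nz by (simp add: order_degree)
  moreover have "degree p + degree q = n"
    using nz assms degree_mult_eq [of p q] by (simp add: degree_monom_eq)
  ultimately show ?thesis by simp
qed

lemma peval_constant_if_mult_eq_affine_power:
  fixes P Q :: "'n::finite rpoly"
  assumes "a \<noteq> 0" "a \<bullet> y = b" "peval P y \<noteq> 0"
    and PQ: "\<And>x. peval P x * peval Q x = (a \<bullet> x - b) ^ n"
  shows "peval P x = peval P y"
proof -
  have off: "peval P z = peval P y" if "a \<bullet> z \<noteq> b" for z
  proof -
    define w where "w = z - y"
    obtain p where p: "\<And>t. poly p t = peval P (y + t *\<^sub>R w)"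
      using peval_line by metis
    obtain q where q: "\<And>t. poly q t = peval Q (y + t *\<^sub>R w)"
      using peval_line by metis
    have "poly (p * q) t = poly (monom ((a \<bullet> w) ^ n) n) t" for t
      by (simp add: p q PQ poly_monom inner_add_right assms(2) power_mult_distrib mult.commute)
    then have "p * q = monom ((a \<bullet> w) ^ n) n"
      by (metis poly_eq_poly_eq_iff ext)
    moreover have "(a \<bullet> w) ^ n \<noteq> 0"
      using that assms(2) by (simp add: w_def inner_diff_right)
    moreover have "poly p 0 \<noteq> 0"
      using assms(3) by (simp add: p)
    ultimately have "degree p = 0"
      by (rule degree_eq_0_if_mult_eq_monom)
    then obtain c where "p = [:c:]"
      by (rule degree_eq_zeroE)
    then show ?thesis
      using p [of 0] p [of 1] by (simp add: w_def)
  qed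
  show ?thesis
  proof (cases "a \<bullet> x = b")
    case True
    \<comment> \<open>Lines through \<open>y\<close> inside the hyperplane give no information. The
      normal line through \<open>x\<close> leaves the hyperplane for every \<open>t\<close> except
      0, so \<open>p\<close> takes the value at \<open>y\<close> infinitely often.\<close>
    obtain p where p: "\<And>t. poly p t = peval P (x + t *\<^sub>R a)"
      using peval_line by metis
    have "-{0} \<subseteq> {t. poly (p - [:peval P y:]) t = 0}"
      using off True assms(1) by (auto simp: p inner_add_right)
    moreover have "infinite (-{0::real})"
      by (metis finite.emptyI finite_compl finite_insert infinite_UNIV_char_0)
    ultimately have "p - [:peval P y:] = 0"
      using poly_roots_finite finite_subset by blast
    then show ?thesis
      using p [of 0] by simp
  qed (rule off)
qed

section \<open>Points near the indeterminacy set\<close>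

text \<open>With \<open>p = s * q\<close>, the square is \<open>s\<close> times
  \<open>s * q\<^sup>2\<close>, and the latter factor tends to 0.\<close>

lemma eventually_poly_square_less:
  fixes p :: "real poly"
  assumes "poly p 0 = 0"
  shows "eventually (\<lambda>s. (poly p s)\<^sup>2 < s) (at_right 0)"
proof -
  obtain q where q: "p = [:0, 1:] * q"
    using assms by (auto simp: poly_eq_0_iff_dvd)
  have "((\<lambda>s. s * (poly q s)\<^sup>2) \<longlongrightarrow> 0 * (poly q 0)\<^sup>2) (at_right 0)"
    by (intro tendsto_intros)
  then have "eventually (\<lambda>s. s * (poly q s)\<^sup>2 < 1) (at_right 0)"
    by (rule order_tendstoD(2)) simp
  then show ?thesis
    using eventually_at_right_less [of "0::real"]
  proof eventually_elim
    case (elim s)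
    then have "s * (s * (poly q s)\<^sup>2) < s * 1"
      by (intro mult_strict_left_mono)
    then show ?case
      by (simp add: q power2_eq_square algebra_simps)
  qed
qed

lemma eventually_poly_nonzero_at_right:
  fixes p :: "real poly"
  assumes "p \<noteq> 0"
  shows "eventually (\<lambda>t. poly p t \<noteq> 0) (at_right a)"
proof -
  have "open (- ({t. poly p t = 0} - {a}))"
    using poly_roots_finite [OF assms] by (intro open_Compl finite_imp_closed) auto
  then have "eventually (\<lambda>t. t \<in> - ({t. poly p t = 0} - {a}) ) (nhds a)"
    by (intro eventually_nhds_in_open) auto
  then show ?thesis
    by (auto simp: eventually_at_filter elim: eventually_mono)
qed

text \<open>Work in the plane through \<open>x0\<close> spanned by \<open>u\<close>, which points to
  \<open>y\<close> inside the hyperplane, and the normal \<open>v\<close>. A small shift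
  \<open>t\<close> along \<open>u\<close> avoids the zeros of \<open>F\<close>; the intermediate
  value theorem is then applied along \<open>v\<close>.\<close>

lemma exists_affine_eq_square_near:
  fixes F :: "'n::finite rpoly"
  assumes a: "a \<noteq> 0" and y: "a \<bullet> y = b" "peval F y \<noteq> 0"
    and x0: "a \<bullet> x0 = b" "peval F x0 = 0" and "d > 0"
  shows "\<exists>x. dist x0 x < d \<and> a \<bullet> x - b = (peval F x)\<^sup>2 \<and> peval F x \<noteq> 0"
proof -
  \<comment> \<open>Scaled so that \<open>a \<bullet> v = 1\<close>: the parameter \<open>s\<close>
    is the value of the affine form.\<close>
  define v where "v = a /\<^sub>R (a \<bullet> a)"
  define u where "u = y - x0"
  define z where "z t s = x0 + t *\<^sub>R u + s *\<^sub>R v" for t s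
  have az: "a \<bullet> z t s - b = s" for t s
    using a y(1) x0(1) by (simp add: z_def u_def v_def inner_add_right inner_diff_right)
  obtain p where p: "\<And>s. poly p s = peval F (x0 + s *\<^sub>R v)"
    using peval_line by metis
  obtain q where q: "\<And>t. poly q t = peval F (x0 + t *\<^sub>R u)"
    using peval_line by metis
  have "poly q 1 \<noteq> 0"
    using y by (simp add: q u_def)
  then have "q \<noteq> 0" by auto
  have small: "eventually (\<lambda>s. s * norm w < d / 2) (at_right 0)" for w :: "real ^ 'n"
  proof -
    have "((\<lambda>s. s * norm w) \<longlongrightarrow> 0 * norm w) (at_right 0)"
      by (intro tendsto_intros)
    then show ?thesis
      by (rule order_tendstoD(2)) (use \<open>d > 0\<close> in simp)
  qed
  have "eventually (\<lambda>s. (poly p s)\<^sup>2 < s \<and> s * norm v < d / 2 \<and> 0 < s) (at_right 0)"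
    using eventually_poly_square_less [of p] small [of v] eventually_at_right_less [of "0::real"]
    by (auto simp: p x0 eventually_conj_iff)
  then obtain \<delta> where \<delta>: "(poly p \<delta>)\<^sup>2 < \<delta>" "\<delta> * norm v < d / 2" "0 < \<delta>"
    using eventually_happens trivial_limit_at_right_real by blast
  \<comment> \<open>The height \<open>\<delta>\<close> is fixed first, above \<open>x0\<close>; by
    continuity the strict inequality survives small shifts \<open>t\<close>.\<close>
  have "continuous_on UNIV (\<lambda>t. (peval F (z t \<delta>))\<^sup>2)"
    unfolding z_def by (intro continuous_intros)
  then have "((\<lambda>t. (peval F (z t \<delta>))\<^sup>2) \<longlongrightarrow> (peval F (z 0 \<delta>))\<^sup>2) (at_right 0)"
    by (auto simp: continuous_on_def intro: tendsto_within_subset)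
  then have "eventually (\<lambda>t. (peval F (z t \<delta>))\<^sup>2 < \<delta>) (at_right 0)"
    by (rule order_tendstoD(2)) (use \<delta>(1) in \<open>simp add: p z_def\<close>)
  then have "eventually (\<lambda>t. (peval F (z t \<delta>))\<^sup>2 < \<delta> \<and> t * norm u < d / 2 \<and> poly q t \<noteq> 0 \<and> 0 < t)
      (at_right 0)"
    using small [of u] eventually_poly_nonzero_at_right [OF \<open>q \<noteq> 0\<close>, of 0]
      eventually_at_right_less [of "0::real"]
    by (auto simp: eventually_conj_iff)
  then obtain t where t: "(peval F (z t \<delta>))\<^sup>2 < \<delta>" "t * norm u < d / 2" "poly q t \<noteq> 0" "0 < t"
    using eventually_happens trivial_limit_at_right_real by blast
  have "\<exists>s\<ge>0. s \<le> \<delta> \<and> s - (peval F (z t s))\<^sup>2 = 0"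
  proof (rule IVT')
    show "continuous_on {0..\<delta>} (\<lambda>s. s - (peval F (z t s))\<^sup>2)"
      unfolding z_def by (intro continuous_intros)
  qed (use t \<delta> in auto)
  then obtain s where s: "0 \<le> s" "s \<le> \<delta>" "s = (peval F (z t s))\<^sup>2"
    by auto
  \<comment> \<open>A zero of \<open>F\<close> here would force \<open>s = 0\<close>, and
    \<open>t\<close> was chosen so that \<open>F\<close> does not vanish at
    \<open>z t 0\<close>.\<close>
  have "peval F (z t s) \<noteq> 0"
  proof
    assume eq: "peval F (z t s) = 0"
    with s(3) have "s = 0" by simp
    with eq t(3) show False by (simp add: q z_def)
  qed
  moreover have "dist x0 (z t s) < d"
  proof -
    have "dist x0 (z t s) = norm (t *\<^sub>R u + s *\<^sub>R v)"
      by (simp add: z_def dist_norm norm_minus_commute add_ac)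
    also have "\<dots> \<le> t * norm u + s * norm v"
      using norm_triangle_ineq [of "t *\<^sub>R u" "s *\<^sub>R v"] t s by simp
    also have "s * norm v \<le> \<delta> * norm v"
      using s by (intro mult_right_mono) auto
    finally show ?thesis
      using t \<delta> by simp
  qed
  ultimately show ?thesis
    using az [of t s] s(3) by metis
qed

section \<open>The rational function and its properties\<close>

theorem theorem7p10:
  fixes A :: "(real ^ 'n::finite) set" and x0 :: "real ^ 'n"
  assumes "real_algebraic A"
    and "\<exists>H. is_hyperplane H \<and> A \<subset> H"
    and "x0 \<in> A"
  shows "\<exists>r>0. \<exists>N D :: 'n rpoly.
           D \<noteq> 0
         \<and> indeterminacy_set N D = A
         \<and> no_common_factors N D
         \<and> ratfun_bounded_on (ball x0 r) N D
         \<and> (\<forall>U. x0 \<in> interior U \<longrightarrow> \<not> continuous_on U (ratfun_extension N D))"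
proof -
  obtain F where F: "A = zero_set F"
    using assms(1) by (auto simp: real_algebraic_def)
  obtain H where H: "affine H" "aff_dim H = int CARD('n) - 1" "A \<subset> H"
    using assms(2) by (auto simp: is_hyperplane_def)
  obtain a b where a: "a \<noteq> 0" and Hab: "H = {x. a \<bullet> x = b}"
    using H(2) aff_dim_eq_hyperplane [of H] hull_same [of affine H, OF H(1)] by auto
  \<comment> \<open>Strictness of the inclusion supplies this point.\<close>
  obtain y where y: "a \<bullet> y = b" "peval F y \<noteq> 0"
    using H(3) Hab F by (auto simp: zero_set_def)
  have x0: "a \<bullet> x0 = b" "peval F x0 = 0"
    using H(3) Hab F assms(3) by (auto simp: zero_set_def)
  obtain L :: "'n rpoly" where L: "\<And>x. peval L x = a \<bullet> x - b"
    using peval_affine_form by metis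
  define N where "N = L * F ^ 2"
  define D where "D = L ^ 2 + F ^ 4"
  have N_eval: "peval N x = (a \<bullet> x - b) * (peval F x)\<^sup>2" for x
    by (simp add: N_def L)
  have D_eval: "peval D x = (a \<bullet> x - b)\<^sup>2 + ((peval F x)\<^sup>2)\<^sup>2" for x
    by (simp add: D_def L)
  have D_zero: "peval D x = 0 \<longleftrightarrow> a \<bullet> x = b \<and> peval F x = 0" for x
    unfolding D_eval sum_power2_eq_zero_iff by simp
  have "D \<noteq> 0"
    using D_zero [of y] y by auto
  moreover have "indeterminacy_set N D = A"
    using H(3) by (auto simp: indeterminacy_set_def zero_set_def N_eval D_zero F Hab)
  moreover have "no_common_factors N D"
    unfolding no_common_factors_def
  proof (intro allI impI)
    fix P assume P: "P dvd N \<and> P dvd D"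
    \<comment> \<open>These combinations cancel the mixed terms and leave pure powers.\<close>
    have "L ^ 3 = L * D - F ^ 2 * N" "F ^ 6 = F ^ 2 * D - L * N"
      by (simp_all add: N_def D_def algebra_simps power_add [symmetric] eval_nat_numeral)
    with P have "P dvd L ^ 3" "P dvd F ^ 6"
      by (simp_all add: dvd_diff)
    then obtain Q R where Q: "L ^ 3 = P * Q" and R: "F ^ 6 = P * R"
      by (auto elim!: dvdE)
    have "peval P y \<noteq> 0"
      using y(2) arg_cong [OF R, of "\<lambda>S. peval S y"] by auto
    moreover have "peval P x * peval Q x = (a \<bullet> x - b) ^ 3" for x
      using arg_cong [OF Q, of "\<lambda>S. peval S x"] by (simp add: L)
    ultimately show "is_constant P"
      using peval_constant_if_mult_eq_affine_power [OF a y(1)] is_constant_if_peval_constant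
      by metis
  qed
  \<comment> \<open>The estimate is global, so the radius 1 is arbitrary.\<close>
  moreover have "ratfun_bounded_on (ball x0 1) N D"
    unfolding ratfun_bounded_on_def
  proof (intro exI [of _ 1] ballI)
    fix x assume "x \<in> ball x0 1 - zero_set D"
    define l g where "l = a \<bullet> x - b" and "g = (peval F x)\<^sup>2"
    have "2 * (\<bar>l\<bar> * \<bar>g\<bar>) \<le> l\<^sup>2 + g\<^sup>2"
      using sum_squares_bound [of "\<bar>l\<bar>" "\<bar>g\<bar>"] by simp
    then have "\<bar>l * g\<bar> \<le> l\<^sup>2 + g\<^sup>2"
      using mult_nonneg_nonneg [OF abs_ge_zero abs_ge_zero, of l g] unfolding abs_mult by linarith
    then have "\<bar>l * g / (l\<^sup>2 + g\<^sup>2)\<bar> \<le> 1"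
      by (auto simp: abs_divide divide_le_eq_1 sum_power2_gt_zero_iff)
    then show "\<bar>peval N x / peval D x\<bar> \<le> 1"
      unfolding N_eval D_eval l_def g_def .
  qed
  moreover have "\<not> continuous_on U (ratfun_extension N D)" if "x0 \<in> interior U" for U
  proof
    assume cont: "continuous_on U (ratfun_extension N D)"
    have f0: "ratfun_extension N D x0 = 0"
      using x0 by (simp add: ratfun_extension_def zero_set_def D_zero)
    obtain e where e: "e > 0" "ball x0 e \<subseteq> U"
      using \<open>x0 \<in> interior U\<close> unfolding mem_interior by blast
    then have "x0 \<in> U" by auto
    \<comment> \<open>The tolerance \<open>1 / 2\<close> equals the value at the nearby points, so
      the strict inequality fails there.\<close>
    then obtain d where d: "d > 0"
      "\<And>x. x \<in> U \<Longrightarrow> dist x x0 < d \<Longrightarrow> dist (ratfun_extension N D x) (ratfun_extension N D x0) < 1 / 2"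
      using cont unfolding continuous_on_iff by (metis half_gt_zero zero_less_one)
    obtain x where x: "dist x0 x < min d e" "a \<bullet> x - b = (peval F x)\<^sup>2" "peval F x \<noteq> 0"
      using exists_affine_eq_square_near [OF a y x0, of "min d e"] d e by auto
    have "ratfun_extension N D x = 1 / 2"
      using x(2,3) by (simp add: ratfun_extension_def zero_set_def D_zero)
        (simp add: N_eval D_eval x(2) power2_eq_square)
    moreover have "x \<in> U"
      using x e by auto
    ultimately show False
      using d(2) [of x] x f0 by (simp add: dist_commute)
  qed
  ultimately show ?thesis
    using zero_less_one by blast
qed

end
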